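(* Let $n,k$ be positive integers with $n\geq 2k^2+8k$, and let $\mathcal{F}\subset \binom{[n]}{k}$ be intersecting. Then $$|\mathcal{F}\wedge \mathcal{F}|\leq \sum_{0\leq i\leq k-1}\binom{n-1}{i},$$ where equality holds if and only if $\mathcal{F}=\mathcal{S}_{1}$ up to isomorphism.
   Context: $[n]=\{1,2,\ldots,n\}$ and $\binom{[n]}{k}$ is the collection of all $k$-element subsets of $[n]$. A family $\mathcal{F}\subset\binom{[n]}{k}$ is intersecting if $F\cap F'\neq\emptyset$ for all $F,F'\in\mathcal{F}$. Define $\mathcal{F}\wedge\mathcal{F}=\{F\cap F'\colon F,F'\in\mathcal{F}\}$ (here $F=F'$ is allowed). $\mathcal{S}_1=\{S\in\binom{[n]}{k}\colon 1\in S\}$. "Up to isomorphism" means up to applying a permutation of $[n]$. *)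

theory Defs
  imports "HOL-Library.Ramsey" "HOL-Combinatorics.Permutations"
begin

definition intersecting :: "'a set set \<Rightarrow> bool" where
  "intersecting \<F> \<longleftrightarrow> (\<forall>F\<in>\<F>. \<forall>F'\<in>\<F>. F \<inter> F' \<noteq> {})"

definition wedge :: "'a set set \<Rightarrow> 'a set set \<Rightarrow> 'a set set" (infixl "\<and>\<^sub>F" 70) where
  "\<F> \<and>\<^sub>F \<G> = {F \<inter> G | F G. F \<in> \<F> \<and> G \<in> \<G>}"

definition full_star :: "nat \<Rightarrow> nat \<Rightarrow> nat \<Rightarrow> nat set set" where
  "full_star n k i = {S \<in> nsets {1..n} k. i \<in> S}"

text \<open>A permutation of the ground set acts on a family by replacing each member with its image.\<close>

definition isomorphic_on :: "'a set \<Rightarrow> 'a set set \<Rightarrow> 'a set set \<Rightarrow> bool" where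
  "isomorphic_on X \<F> \<G> \<longleftrightarrow> (\<exists>\<pi>. \<pi> permutes X \<and> \<F> = (\<lambda>S. \<pi> ` S) ` \<G>)"

end

theory Submission
  imports Complex_Main Defs
begin

text \<open>
If some \<open>x\<close> lies in all members of \<open>\<F>\<close>, then \<open>\<F> \<and>\<^sub>F \<F>\<close> consists of sets of size at most \<open>k\<close>
through \<open>x\<close>, and the sum of binomial coefficients counts exactly these. The full star attains all of
them, and nothing smaller does, because an intersection of size \<open>k\<close> is itself a member.

It remains to show that a family without a common element falls strictly short. Put \<open>p = k / n\<close>,
\<open>u = k p\<close> and \<open>M = (n - 1) choose (k - 1)\<close>, the largest summand; the assumption on \<open>n\<close> says
\<open>2 u + 8 p \<le> 1\<close>. The intersections of size at most \<open>k - 2\<close> number at most the remaining summands plus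
\<open>2 p\<^sup>2 M\<close>, simply because there are few such subsets. So the members of \<open>\<F>\<close> and the
intersections of size \<open>k - 1\<close> must together number less than \<open>(1 - 2 p\<^sup>2) M\<close>.

The tool is branching (\<open>card_branching\<close>): if the sets of a family \<open>\<A>\<close> meet all members of a family
\<open>\<G>\<close> of sets of size at most \<open>k\<close>, then a set in \<open>\<A>\<close> that contains some \<open>S\<close> which misses
\<open>G \<in> \<G>\<close> contains \<open>S\<close> and one of the at most \<open>k\<close> elements of \<open>G\<close>. As long as no \<open>t - 1\<close> points cover
\<open>\<G>\<close>, this can be repeated \<open>t\<close> times. Each step offers \<open>k\<close> choices and fixes one more element, which leaves
a fraction of about \<open>k / n\<close> of the sets; so it multiplies the bound by \<open>u \<le> 1 / 2\<close>.

Let \<open>T\<close> be a minimum cover of \<open>\<F>\<close>, and \<open>t = card T\<close>; then \<open>2 \<le> t \<le> k\<close>. Starting the branching in \<open>T\<close>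
yields \<open>card \<F> \<le> t u\<^bsup>t-1\<^esup> M\<close>. The \<open>(k - 1)\<close>-sets that meet \<open>T\<close> number at most \<open>t p M\<close>. An intersection
\<open>b\<close> of size \<open>k - 1\<close> that is disjoint from \<open>T\<close> has two extensions \<open>insert x b\<close>, \<open>insert y b\<close> in \<open>\<F>\<close> with
distinct \<open>x, y \<in> T\<close>. It therefore meets every member that has just one element in \<open>T\<close>, and branching
again bounds the number of these \<open>b\<close> by \<open>u\<^sup>2 M\<close>, unless one element is common to all such
members; then that element lies in each \<open>b\<close>, which leaves at most \<open>p M\<close> of them.

These bounds suffice for \<open>t \<ge> 3\<close>. For \<open>t = 2\<close> the bound \<open>2 u M\<close> on \<open>card \<F>\<close> is too weak, and the two
links of \<open>\<F>\<close> at the points of \<open>T\<close> replace it: they are cross-intersecting, so each is bounded by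
branching on the other. Either both have size at most \<open>u\<^sup>2 M\<close>, or one of them has a common
element and size at most \<open>p M\<close> while the other has size at most \<open>u M\<close>.
\<close>

section \<open>Counting by branching\<close>

text \<open>
The left side divided by the binomial coefficient on the right is a product of \<open>s\<close> factors
\<open>(m - i) / (n - i)\<close>, none of which exceeds \<open>m / n\<close>.
\<close>

lemma binomial_shift_le:
  assumes "s \<le> m" "m \<le> n"
  shows "real ((n - s) choose (m - s)) \<le> (real m / real n) ^ s * real (n choose m)"
  using assms(1)
proof (induction s)
  case 0
  then show ?case by simp
next
  case (Suc s)
  let ?a = "n - s" and ?b = "m - s"
  have b: "?b > 0" "?b \<le> ?a" using Suc.prems assms(2) by auto
  have "?b * (?a choose ?b) = ?a * ((?a - 1) choose (?b - 1))"
    using times_binomial_minus1_eq[OF b(1)] by simp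
  then have "real ?b * real (?a choose ?b) = real ?a * real ((?a - 1) choose (?b - 1))"
    by (metis of_nat_mult)
  then have eq: "real ((?a - 1) choose (?b - 1)) = real ?b / real ?a * real (?a choose ?b)"
    using b by (simp add: nonzero_eq_divide_eq mult.commute)
  have "real s * real m \<le> real s * real n" using assms(2) by (intro mult_left_mono) auto
  then have ratio: "real ?b / real ?a \<le> real m / real n"
    using b Suc.prems assms(2) by (simp add: divide_simps of_nat_diff algebra_simps)
  have "real ((n - Suc s) choose (m - Suc s)) = real ?b / real ?a * real (?a choose ?b)"
    using eq by simp
  also have "\<dots> \<le> real m / real n * ((real m / real n) ^ s * real (n choose m))"
    using ratio Suc by (intro mult_mono) auto
  finally show ?case by simp
qed

text \<open>
The estimate remains true when \<open>card S > m\<close>, where no such set exists; the corresponding binomial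
coefficient with truncated subtraction would be \<open>1\<close>. This is why all later counts use powers of
\<open>m / card X\<close>.
\<close>

lemma card_nsets_superset_le:
  assumes X: "finite X" and m: "m \<le> card X"
  shows "real (card {A \<in> nsets X m. S \<subseteq> A})
    \<le> (real m / real (card X)) ^ card S * real (card X choose m)"
proof (cases "S \<subseteq> X \<and> card S \<le> m")
  case True
  then have S: "S \<subseteq> X" "finite S" "card S \<le> m" using X finite_subset by auto
  have "{A \<in> nsets X m. S \<subseteq> A} \<subseteq> (\<union>) S ` nsets (X - S) (m - card S)"
  proof
    fix A assume "A \<in> {A \<in> nsets X m. S \<subseteq> A}"
    then have A: "A \<subseteq> X" "finite A" "card A = m" "S \<subseteq> A" by (auto simp: nsets_def)
    then have "A = S \<union> (A - S)" "A - S \<in> nsets (X - S) (m - card S)"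
      using S by (auto simp: nsets_def card_Diff_subset)
    then show "A \<in> (\<union>) S ` nsets (X - S) (m - card S)" by blast
  qed
  moreover have fin: "finite (nsets (X - S) (m - card S))" using X by (simp add: finite_imp_finite_nsets)
  ultimately have "card {A \<in> nsets X m. S \<subseteq> A} \<le> card (nsets (X - S) (m - card S))"
    by (meson card_image_le card_mono finite_imageI le_trans)
  also have "\<dots> = (card X - card S) choose (m - card S)"
    using S by (simp add: card_nsets card_Diff_subset)
  finally have "real (card {A \<in> nsets X m. S \<subseteq> A}) \<le> real ((card X - card S) choose (m - card S))"
    by simp
  then show ?thesis using binomial_shift_le[OF S(3) m] by linarith
next
  case False
  then have "{A \<in> nsets X m. S \<subseteq> A} = {}"
    using card_mono by (fastforce simp: nsets_def)
  then show ?thesis by (simp only: card.empty) simp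
qed

definition cover :: "'a set \<Rightarrow> 'a set set \<Rightarrow> bool" where
  "cover S \<G> \<longleftrightarrow> finite S \<and> (\<forall>G\<in>\<G>. S \<inter> G \<noteq> {})"

text \<open>
The elements common to all members are exactly the one-element covers.
\<close>

lemma two_le_card_cover:
  assumes "cover S \<G>" "\<nexists>z. \<forall>G\<in>\<G>. z \<in> G"
  shows "2 \<le> card S"
proof (rule ccontr)
  assume "\<not> ?thesis"
  then have "\<forall>x\<in>S. \<forall>y\<in>S. x = y"
    using assms(1) card_le_Suc0_iff_eq[of S] by (auto simp: cover_def)
  then obtain z where "S \<subseteq> {z}" by (cases "S = {}") blast+
  then show False using assms by (auto simp: cover_def)
qed

text \<open>
A set in \<open>\<A>\<close> that contains \<open>S\<close> must also contain an element of a member of \<open>\<G>\<close> missed by \<open>S\<close>. Such a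
member exists as long as \<open>card S < t\<close>, so \<open>S\<close> grows to size \<open>t\<close> with at most \<open>k\<close> choices
at each step.
\<close>

lemma card_branching:
  assumes X: "finite X" and m: "m \<le> card X" and \<A>: "\<A> \<subseteq> nsets X m"
    and \<G>: "\<And>G. G \<in> \<G> \<Longrightarrow> finite G \<and> card G \<le> k"
    and meet: "\<And>A G. A \<in> \<A> \<Longrightarrow> G \<in> \<G> \<Longrightarrow> A \<inter> G \<noteq> {}"
    and nocover: "\<And>S. cover S \<G> \<Longrightarrow> t \<le> card S"
    and S: "finite S" "card S \<le> t"
  shows "real (card {A \<in> \<A>. S \<subseteq> A})
    \<le> real k ^ (t - card S) * (real m / real (card X)) ^ t * real (card X choose m)"
  using S
proof (induction "t - card S" arbitrary: S)
  case 0
  then have "card S = t" by simp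
  moreover have "card {A \<in> \<A>. S \<subseteq> A} \<le> card {A \<in> nsets X m. S \<subseteq> A}"
    using \<A> X by (intro card_mono) (auto simp: finite_imp_finite_nsets)
  ultimately show ?case using card_nsets_superset_le[OF X m, of S] by simp
next
  case (Suc d)
  then have "card S < t" by simp
  then obtain G where G: "G \<in> \<G>" "S \<inter> G = {}"
    using nocover[of S] Suc.prems unfolding cover_def by force
  define w where "w = (real m / real (card X)) ^ t * real (card X choose m)"
  have w0: "w \<ge> 0" by (simp add: w_def)
  have finA: "finite \<A>" using \<A> X by (meson finite_imp_finite_nsets finite_subset)
  have step: "real (card {A \<in> \<A>. insert y S \<subseteq> A}) \<le> real k ^ d * w" if "y \<in> G" for y
  proof -
    have "card (insert y S) = Suc (card S)"
      using that G(2) Suc.prems(1) by (intro card_insert_disjoint) blast+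
    then have d: "d = t - card (insert y S)" "card (insert y S) \<le> t"
      using Suc.hyps(2) by auto
    show ?thesis
      using Suc.hyps(1)[OF d(1) _ d(2)] Suc.prems(1) d(1)[symmetric] by (simp add: w_def mult.assoc)
  qed
  have "{A \<in> \<A>. S \<subseteq> A} \<subseteq> (\<Union>y\<in>G. {A \<in> \<A>. insert y S \<subseteq> A})"
    using meet[OF _ G(1)] by fastforce
  then have "card {A \<in> \<A>. S \<subseteq> A} \<le> card (\<Union>y\<in>G. {A \<in> \<A>. insert y S \<subseteq> A})"
    using finA \<G>[OF G(1)] by (intro card_mono) auto
  also have "\<dots> \<le> (\<Sum>y\<in>G. card {A \<in> \<A>. insert y S \<subseteq> A})"
    using \<G>[OF G(1)] by (intro card_UN_le) auto
  finally have "real (card {A \<in> \<A>. S \<subseteq> A}) \<le> (\<Sum>y\<in>G. real (card {A \<in> \<A>. insert y S \<subseteq> A}))"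
    unfolding of_nat_sum[symmetric] of_nat_le_iff .
  also have "\<dots> \<le> real (card G) * (real k ^ d * w)"
    using step by (rule sum_bounded_above)
  also have "\<dots> \<le> real k * (real k ^ d * w)"
    using \<G>[OF G(1)] w0 by (intro mult_right_mono) auto
  also have "\<dots> = real k ^ (t - card S) * w" using Suc.hyps(2)[symmetric] by simp
  finally show ?case by (simp add: w_def mult.assoc)
qed

section \<open>Families without a common element\<close>

text \<open>
The negation of having a common element ranges over the whole type, so it also forces \<open>\<F>\<close> to be
nonempty.
\<close>

locale nontrivial_intersecting =
  fixes X :: "'a set" and \<F> :: "'a set set" and k :: nat
  assumes finX: "finite X"
    and uniform: "\<F> \<subseteq> nsets X k"
    and intersecting: "intersecting \<F>"
    and nontrivial: "\<And>x. \<exists>F\<in>\<F>. x \<notin> F"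
    and large: "2 * k\<^sup>2 + 8 * k \<le> card X"
begin

text \<open>
The two quantities in which all bounds are expressed: \<open>p\<close> is the density of a member in \<open>X\<close>, and \<open>M\<close>
is the number of \<open>k\<close>-sets through a given point.
\<close>

definition p :: real where "p = real k / real (card X)"
definition M :: real where "M = real ((card X - 1) choose (k - 1))"

lemma memberD: "F \<in> \<F> \<Longrightarrow> F \<subseteq> X \<and> finite F \<and> card F = k"
  using uniform by (auto simp: nsets_def)

lemma meetD: "F \<in> \<F> \<Longrightarrow> G \<in> \<F> \<Longrightarrow> F \<inter> G \<noteq> {}"
  using intersecting by (auto simp: intersecting_def)

lemma finF: "finite \<F>"
  using uniform finX by (meson finite_imp_finite_nsets finite_subset)

lemma k2: "2 \<le> k"
proof -
  obtain F where F: "F \<in> \<F>" using nontrivial by blast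
  then obtain x where x: "x \<in> F" using meetD[OF F F] by auto
  obtain G where G: "G \<in> \<F>" "x \<notin> G" using nontrivial by blast
  then obtain y where y: "y \<in> F" "y \<noteq> x" using meetD[OF F G(1)] by auto
  have "card {x, y} \<le> card F" using x y memberD[OF F] by (intro card_mono) auto
  then show ?thesis using y memberD[OF F] by auto
qed

lemma k_le_n: "2 * k \<le> card X" "k\<^sup>2 \<le> card X"
  using large by auto

text \<open>
The last inequality is the hypothesis \<open>large\<close> divided by \<open>card X\<close>. The bound \<open>1 / 12\<close> follows from it
because \<open>k \<ge> 2\<close>.
\<close>

lemma p_bounds: "0 < p" "p \<le> 1 / 12" "2 * (real k * p) + 8 * p \<le> 1"
proof -
  have n: "real (card X) \<ge> 2 * real k ^ 2 + 8 * real k" using large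
    by (metis (mono_tags) of_nat_add of_nat_le_iff of_nat_mult of_nat_numeral of_nat_power)
  have k: "real k \<ge> 2" using k2 by simp
  have n0: "real (card X) > 0" using n k by (smt (verit) zero_le_power2)
  show "0 < p" using n0 k by (simp add: p_def)
  have "2 * (real k * p) + 8 * p = (2 * real k ^ 2 + 8 * real k) / real (card X)"
    by (simp add: p_def power2_eq_square add_divide_distrib)
  then show *: "2 * (real k * p) + 8 * p \<le> 1" using n n0 by (metis divide_le_eq_1_pos)
  have "2 * p \<le> real k * p" using k \<open>0 < p\<close> by simp
  then show "p \<le> 1 / 12" using * by linarith
qed

lemma M_pos: "0 < M"
  using k_le_n k2 by (simp add: M_def)

text \<open>
The left side is the bound of \<open>card_nsets_superset_le\<close> for \<open>k\<close>-sets, rewritten with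
\<open>p * (card X choose k) = M\<close>.
\<close>

lemma weight_k:
  assumes "1 \<le> s"
  shows "(real k / real (card X)) ^ s * real (card X choose k) = p ^ (s - 1) * M"
proof -
  have "k * (card X choose k) = card X * ((card X - 1) choose (k - 1))"
    using k2 by (intro times_binomial_minus1_eq) auto
  then have "real k * real (card X choose k) = real (card X) * M"
    by (metis M_def of_nat_mult)
  moreover have "real (card X) > 0" using k_le_n k2 by simp
  ultimately have "p * real (card X choose k) = M" by (simp add: p_def field_simps)
  moreover have "p ^ s = p ^ (s - 1) * p" using assms by (cases s) auto
  ultimately show ?thesis by (simp only: p_def[symmetric] mult.assoc)
qed

text \<open>
For \<open>(k - 1)\<close>-sets one more factor \<open>p\<close> is gained: through a given point there are
\<open>(k - 1) / (card X - k + 1) * M\<close> of them, and \<open>(k - 1) / (card X - k + 1) \<le> p\<close> since \<open>k * (k - 1) \<le> card X\<close>.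
\<close>

lemma weight_k1:
  assumes "1 \<le> s"
  shows "(real (k - 1) / real (card X)) ^ s * real (card X choose (k - 1)) \<le> p ^ s * M"
proof -
  let ?n = "card X"
  have n: "real ?n > 0" "k - 1 < ?n" using k_le_n k2 by auto
  have "(?n - (k - 1)) * (?n choose (k - 1)) = ?n * ((?n - 1) choose (k - 1))"
    by (rule binomial_absorb_comp)
  then have "real (?n - (k - 1)) * real (?n choose (k - 1)) = real ?n * M"
    by (metis M_def of_nat_mult)
  then have eq: "real (?n choose (k - 1)) = real ?n * M / (real ?n - (real k - 1))"
    using n k2 by (simp add: field_simps of_nat_diff)
  have "real k * (real k - 1) \<le> real ?n"
  proof -
    have "real k * real k \<le> real ?n"
      using k_le_n(2) by (metis of_nat_le_iff of_nat_mult power2_eq_square)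
    then show ?thesis by (simp add: right_diff_distrib)
  qed
  then have "(real k - 1) / (real ?n - (real k - 1)) \<le> p"
    using n k2 by (simp add: p_def divide_simps of_nat_diff algebra_simps)
  then have "(real k - 1) / (real ?n - (real k - 1)) * M \<le> p * M"
    using M_pos by (intro mult_right_mono) auto
  then have one: "real (k - 1) / real ?n * real (?n choose (k - 1)) \<le> p * M"
    unfolding eq using n k2 by (simp add: of_nat_diff)
  have "real (k - 1) / real ?n \<le> p" by (simp add: p_def divide_right_mono)
  then have "(real (k - 1) / real ?n) ^ (s - 1) \<le> p ^ (s - 1)"
    by (intro power_mono) auto
  then have "(real (k - 1) / real ?n) ^ (s - 1) * (real (k - 1) / real ?n * real (?n choose (k - 1)))
      \<le> p ^ (s - 1) * (p * M)"
    using one by (rule mult_mono) (use p_bounds in auto)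
  moreover have "y ^ s = y ^ (s - 1) * y" for y :: real using assms by (cases s) auto
  ultimately show ?thesis by (simp only: mult.assoc)
qed

text \<open>
Below level \<open>k\<close>, each binomial coefficient is at most \<open>p\<close> times the next one, so the sum is dominated
by a geometric series, and its top term lies two levels below \<open>M\<close>.
\<close>

lemma low_levels_le: "real (\<Sum>i<k - 2. (card X - 1) choose i) \<le> 2 * p\<^sup>2 * M"
proof -
  let ?N = "card X - 1"
  have ratio: "real (?N choose i) \<le> p * real (?N choose Suc i)" if "i + 2 \<le> k" for i
  proof -
    have "Suc i * (?N choose Suc i) = (?N - i) * (?N choose i)"
      using binomial_absorb_comp[of ?N i] binomial_absorption[of i ?N] by simp
    then have e: "real (Suc i) * real (?N choose Suc i) = real (?N - i) * real (?N choose i)"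
      by (metis of_nat_mult)
    have "card X * Suc i \<le> k * (?N - i)"
    proof -
      have "k * i + k \<le> k * k" using that mult_le_mono[of k k "i+1" k] by simp
      also have "\<dots> \<le> card X" using k_le_n by (simp add: power2_eq_square)
      finally have a: "k * Suc i \<le> card X" by simp
      have "card X * Suc i + card X \<le> card X * k" using that mult_le_mono[of "card X" "card X" "i+2" k] by simp
      then have "card X * Suc i \<le> card X * k - k * Suc i" using a by simp
      also have "\<dots> = k * (?N - i)" by (simp add: diff_mult_distrib2 algebra_simps)
      finally show ?thesis .
    qed
    then have "real (card X) * real (Suc i) \<le> real k * real (?N - i)" by (metis of_nat_le_iff of_nat_mult)
    then have "real (card X) * real (Suc i) * real (?N choose Suc i)
        \<le> real k * real (?N - i) * real (?N choose Suc i)" by (intro mult_right_mono) auto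
    then have "real (?N - i) * (real (card X) * real (?N choose i)) \<le> real (?N - i) * (real k * real (?N choose Suc i))"
      using e by (simp add: mult_ac)
    moreover have "real (?N - i) > 0" using that k_le_n by simp
    ultimately have "real (card X) * real (?N choose i) \<le> real k * real (?N choose Suc i)" by (simp del: of_nat_Suc of_nat_diff)
    moreover have "real (card X) > 0" using k_le_n k2 by simp
    ultimately show ?thesis by (simp add: p_def field_simps)
  qed
  have sum: "real (\<Sum>i<m. ?N choose i) \<le> 2 * p * real (?N choose m)" if "m + 1 \<le> k" for m
    using that
  proof (induction m)
    case 0
    then show ?case using p_bounds by simp
  next
    case (Suc m)
    have "real (\<Sum>i<Suc m. ?N choose i) \<le> (2 * p + 1) * real (?N choose m)"
      using Suc by (simp add: algebra_simps)
    also have "\<dots> \<le> 2 * real (?N choose m)" using p_bounds by (intro mult_right_mono) auto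
    also have "\<dots> \<le> 2 * (p * real (?N choose Suc m))" using ratio[of m] Suc.prems by simp
    finally show ?case by simp
  qed
  have "real (\<Sum>i<k - 2. ?N choose i) \<le> 2 * p * real (?N choose (k - 2))"
    using sum[of "k - 2"] k2 by simp
  also have "\<dots> \<le> 2 * p * (p * M)"
    using ratio[of "k - 2"] k2 p_bounds
    by (intro mult_left_mono) (auto simp: M_def Suc_diff_Suc numeral_2_eq_2)
  finally show ?thesis by (simp add: power2_eq_square mult_ac)
qed

section \<open>Intersections of size one less than the members\<close>

lemma obtain_minimum_cover:
  obtains T where "cover T \<F>" "\<And>S. cover S \<F> \<Longrightarrow> card T \<le> card S" "2 \<le> card T" "card T \<le> k"
proof -
  obtain F where F: "F \<in> \<F>" using nontrivial by blast
  have cF: "cover F \<F>" using F meetD memberD by (auto simp: cover_def)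
  obtain T where T: "cover T \<F>" "\<And>S. cover S \<F> \<Longrightarrow> card T \<le> card S"
    using ex_has_least_nat[of "\<lambda>S. cover S \<F>" F card] cF by auto
  have "2 \<le> card T" using two_le_card_cover[OF T(1)] nontrivial by blast
  moreover have "card T \<le> k" using T(2)[OF cF] memberD[OF F] by simp
  ultimately show ?thesis using that T by blast
qed

text \<open>
The intersections of size \<open>k - 1\<close> that avoid \<open>T\<close>. For a cover \<open>T\<close> each of them lies in two links at
points of \<open>T\<close>, as the next elimination rule shows.
\<close>

definition shared :: "'a set \<Rightarrow> 'a set set" where
  "shared T = {b \<in> nsets X (k - 1). b \<inter> T = {} \<and> (\<exists>F\<in>\<F>. \<exists>G\<in>\<F>. b = F \<inter> G)}"

lemma finite_shared: "finite (shared T)"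
  unfolding shared_def using finX by (simp add: finite_imp_finite_nsets)

text \<open>
Both members that produce \<open>b\<close> have to meet \<open>T\<close>, and each has only one element outside \<open>b\<close>. These two
elements differ because the intersection of the members is no larger than \<open>b\<close>.
\<close>

lemma sharedE:
  assumes "b \<in> shared T" "cover T \<F>"
  obtains x y where "x \<in> T" "y \<in> T" "x \<noteq> y" "x \<notin> b" "y \<notin> b" "insert x b \<in> \<F>" "insert y b \<in> \<F>"
proof -
  obtain F G where FG: "F \<in> \<F>" "G \<in> \<F>" "b = F \<inter> G" and b: "card b = k - 1" "finite b" "b \<inter> T = {}"
    using assms by (auto simp: shared_def nsets_def)
  have ex: "\<exists>x\<in>T. H = insert x b \<and> x \<notin> b" if H: "H \<in> \<F>" "b \<subseteq> H" for H
  proof -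
    obtain x where x: "x \<in> T" "x \<in> H" using assms(2) H(1) by (auto simp: cover_def)
    then have "x \<notin> b" using b by auto
    then have "card (insert x b) = k" using b k2 by auto
    then have "insert x b = H" using memberD[OF H(1)] H x
      by (intro card_subset_eq) auto
    then show ?thesis using x \<open>x \<notin> b\<close> by auto
  qed
  obtain x where x: "x \<in> T" "F = insert x b" "x \<notin> b" using ex[of F] FG by blast
  obtain y where y: "y \<in> T" "G = insert y b" "y \<notin> b" using ex[of G] FG by blast
  have "x \<noteq> y" using x(2,3) y(2) FG(3) by (metis Int_absorb insertI1)
  then show ?thesis using x y FG(1,2) by (intro that[of x y]) auto
qed

lemma card_containing_le: "real (card {b \<in> nsets X (k - 1). x \<in> b}) \<le> p * M"
proof -
  have "k - 1 \<le> card X" using k_le_n by simp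
  then show ?thesis
    using card_nsets_superset_le[OF finX, of "k - 1" "{x}"] weight_k1[of 1] by simp
qed

text \<open>
By Pascal's rule the subsets of \<open>X\<close> of size at most \<open>k - 2\<close> exceed the lower summands of the desired
bound only by binomial coefficients of index less than \<open>k - 2\<close>.
\<close>

lemma card_small_sets_le:
  "card {S. S \<subseteq> X \<and> card S \<le> k - 2} \<le> (\<Sum>i\<le>k - 2. (card X - 1) choose i) + (\<Sum>i<k - 2. (card X - 1) choose i)"
proof -
  have "{S. S \<subseteq> X \<and> card S \<le> k - 2} = (\<Union>i\<in>{..k - 2}. nsets X i)"
    using finite_subset[OF _ finX] by (auto simp: nsets_def)
  then have "card {S. S \<subseteq> X \<and> card S \<le> k - 2} \<le> (\<Sum>i\<le>k - 2. card X choose i)"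
    using card_UN_le[of "{..k - 2}" "nsets X"] by (simp add: card_nsets)
  also have "\<dots> = (\<Sum>i\<le>k - 2. (card X - 1) choose i) + (\<Sum>i<k - 2. (card X - 1) choose i)"
  proof -
    obtain N where N: "card X = Suc N" using k_le_n k2 by (cases "card X") auto
    have "(\<Sum>i\<le>m. Suc N choose i) = (\<Sum>i\<le>m. N choose i) + (\<Sum>i<m. N choose i)" for m
      by (induction m) auto
    then show ?thesis by (simp add: N)
  qed
  finally show ?thesis .
qed

text \<open>
An intersection has size at most \<open>k - 2\<close>, or is a member, or has size \<open>k - 1\<close> and then either meets
\<open>T\<close> or belongs to \<open>shared T\<close>. The expression in parentheses must later be shown to be less than \<open>M\<close>.
\<close>

lemma card_wedge_bound:
  assumes T: "cover T \<F>"
  shows "real (card (\<F> \<and>\<^sub>F \<F>)) \<le> real (\<Sum>i\<le>k - 2. (card X - 1) choose i)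
    + (real (card \<F>) + real (card (shared T)) + real (card T) * (p * M) + 2 * p\<^sup>2 * M)"
proof -
  let ?L = "{S. S \<subseteq> X \<and> card S \<le> k - 2}"
  let ?C = "\<lambda>x. {b \<in> nsets X (k - 1). x \<in> b}"
  have finT: "finite T" using T by (simp add: cover_def)
  have "\<F> \<and>\<^sub>F \<F> \<subseteq> ?L \<union> (\<F> \<union> (shared T \<union> (\<Union>x\<in>T. ?C x)))"
  proof
    fix S assume "S \<in> \<F> \<and>\<^sub>F \<F>"
    then obtain F G where FG: "F \<in> \<F>" "G \<in> \<F>" "S = F \<inter> G" by (auto simp: wedge_def)
    note F = memberD[OF FG(1)]
    have S: "S \<subseteq> X" "finite S" "card S \<le> k"
      using F FG(3) card_mono[of F S] by auto
    consider "card S \<le> k - 2" | "card S = k - 1" | "card S = k" using S(3) by linarith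
    then show "S \<in> ?L \<union> (\<F> \<union> (shared T \<union> (\<Union>x\<in>T. ?C x)))"
    proof cases
      case 3
      then have "S = F" using F FG(3) by (intro card_subset_eq) auto
      then show ?thesis using FG by simp
    next
      case 2
      then show ?thesis using S FG by (auto simp: shared_def nsets_def)
    qed (use S in auto)
  qed
  moreover have "finite (?L \<union> (\<F> \<union> (shared T \<union> (\<Union>x\<in>T. ?C x))))"
    using finX finT finF finite_shared by (auto simp: finite_imp_finite_nsets)
  ultimately have "card (\<F> \<and>\<^sub>F \<F>) \<le> card (?L \<union> (\<F> \<union> (shared T \<union> (\<Union>x\<in>T. ?C x))))"
    by (rule card_mono[rotated])
  also have "\<dots> \<le> card ?L + (card \<F> + (card (shared T) + card (\<Union>x\<in>T. ?C x)))"
    by (rule order_trans[OF card_Un_le add_left_mono[OF order_trans[OF card_Un_le add_left_mono[OF card_Un_le]]]])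
  finally have a: "real (card (\<F> \<and>\<^sub>F \<F>))
      \<le> real (card ?L) + (real (card \<F>) + (real (card (shared T)) + real (card (\<Union>x\<in>T. ?C x))))"
    unfolding of_nat_add[symmetric] of_nat_le_iff .
  have "card (\<Union>x\<in>T. ?C x) \<le> (\<Sum>x\<in>T. card (?C x))" by (intro card_UN_le finT)
  then have "real (card (\<Union>x\<in>T. ?C x)) \<le> (\<Sum>x\<in>T. real (card (?C x)))"
    unfolding of_nat_sum[symmetric] of_nat_le_iff .
  also have "\<dots> \<le> real (card T) * (p * M)" by (intro sum_bounded_above card_containing_le)
  finally have b: "real (card (\<Union>x\<in>T. ?C x)) \<le> real (card T) * (p * M)" .
  have "real (card ?L) \<le> real (\<Sum>i\<le>k - 2. (card X - 1) choose i) + real (\<Sum>i<k - 2. (card X - 1) choose i)"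
    using card_small_sets_le unfolding of_nat_add[symmetric] of_nat_le_iff .
  then show ?thesis using a b low_levels_le by linarith
qed

text \<open>
The first branching step uses the \<open>card T\<close> elements of \<open>T\<close> itself, and only the remaining
\<open>card T - 1\<close> steps cost a factor \<open>k\<close>. Minimality of \<open>T\<close> keeps the branching going for that long.
\<close>

lemma card_le_of_minimum_cover:
  assumes T: "cover T \<F>" and min: "\<And>S. cover S \<F> \<Longrightarrow> card T \<le> card S" and T1: "1 \<le> card T"
  shows "real (card \<F>) \<le> real (card T) * (real k * p) ^ (card T - 1) * M"
proof -
  have finT: "finite T" using T by (simp add: cover_def)
  have kn: "k \<le> card X" using k_le_n by simp
  have each: "real (card {F \<in> \<F>. {x} \<subseteq> F}) \<le> (real k * p) ^ (card T - 1) * M" for x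
  proof -
    have "real (card {F \<in> \<F>. {x} \<subseteq> F})
        \<le> real k ^ (card T - card {x}) * (real k / real (card X)) ^ card T * real (card X choose k)"
      by (rule card_branching[where \<G> = \<F>, OF finX kn uniform])
        (use memberD meetD min T1 in auto)
    then show ?thesis using weight_k[OF T1] by (simp add: power_mult_distrib mult.assoc)
  qed
  have "\<F> \<subseteq> (\<Union>x\<in>T. {F \<in> \<F>. {x} \<subseteq> F})" using T by (auto simp: cover_def)
  then have "card \<F> \<le> card (\<Union>x\<in>T. {F \<in> \<F>. {x} \<subseteq> F})"
    using finT finF by (intro card_mono) auto
  also have "\<dots> \<le> (\<Sum>x\<in>T. card {F \<in> \<F>. {x} \<subseteq> F})" using finT by (intro card_UN_le)
  finally have "real (card \<F>) \<le> (\<Sum>x\<in>T. real (card {F \<in> \<F>. {x} \<subseteq> F}))"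
    unfolding of_nat_sum[symmetric] of_nat_le_iff .
  also have "\<dots> \<le> real (card T) * ((real k * p) ^ (card T - 1) * M)"
    by (intro sum_bounded_above each)
  finally show ?thesis by (simp add: mult.assoc)
qed

text \<open>
Branching from the empty set, for families of \<open>(k - 1)\<close>-sets.
\<close>

lemma card_meeting_le:
  assumes \<A>: "\<A> \<subseteq> nsets X (k - 1)"
    and \<G>: "\<And>G. G \<in> \<G> \<Longrightarrow> finite G \<and> card G \<le> k"
    and meet: "\<And>A G. A \<in> \<A> \<Longrightarrow> G \<in> \<G> \<Longrightarrow> A \<inter> G \<noteq> {}"
    and nocover: "\<And>S. cover S \<G> \<Longrightarrow> t \<le> card S" and t: "1 \<le> t"
  shows "real (card \<A>) \<le> (real k * p) ^ t * M"
proof -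
  have kn: "k - 1 \<le> card X" using k_le_n by simp
  have "real (card {A \<in> \<A>. {} \<subseteq> A})
      \<le> real k ^ (t - card ({} :: 'a set)) * (real (k - 1) / real (card X)) ^ t * real (card X choose (k - 1))"
    by (rule card_branching[where \<G> = \<G>, OF finX kn \<A>]) (use \<G> meet nocover in auto)
  then have "real (card \<A>)
      \<le> real k ^ t * ((real (k - 1) / real (card X)) ^ t * real (card X choose (k - 1)))"
    by (simp add: mult.assoc)
  also have "\<dots> \<le> real k ^ t * (p ^ t * M)" using weight_k1[OF t] by (intro mult_left_mono) auto
  finally show ?thesis by (simp add: power_mult_distrib mult.assoc)
qed

text \<open>
Let \<open>\<G>\<close> be the members with exactly one element in \<open>T\<close>. If \<open>b\<close> is in \<open>shared T\<close> and \<open>G \<in> \<G>\<close>, then one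
of the two extensions of \<open>b\<close> adds a point outside \<open>G\<close>, so \<open>G\<close> meets \<open>b\<close> itself. Moreover the two
extensions of \<open>b\<close> are in \<open>\<G>\<close>, so that an element common to \<open>\<G>\<close> lies in their intersection \<open>b\<close>.
\<close>

lemma card_shared_le:
  assumes T: "cover T \<F>"
  shows "real (card (shared T)) \<le> ((real k * p)\<^sup>2 + p) * M"
proof -
  define \<G> where "\<G> = {F \<in> \<F>. \<exists>x. F \<inter> T = {x}}"
  have sub: "shared T \<subseteq> nsets X (k - 1)" by (auto simp: shared_def)
  have pM: "0 \<le> p * M" "0 \<le> (real k * p)\<^sup>2 * M" using p_bounds M_pos by auto
  show ?thesis
  proof (cases "\<exists>z. \<forall>G\<in>\<G>. z \<in> G")
    case True
    then obtain z where z: "\<And>G. G \<in> \<G> \<Longrightarrow> z \<in> G" by blast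
    have "shared T \<subseteq> {b \<in> nsets X (k - 1). z \<in> b}"
    proof
      fix b assume b: "b \<in> shared T"
      then obtain x y where xy: "x \<in> T" "y \<in> T" "x \<noteq> y" "insert x b \<in> \<F>" "insert y b \<in> \<F>"
        using sharedE[OF _ T] by metis
      moreover have "b \<inter> T = {}" using b by (simp add: shared_def)
      ultimately have "insert x b \<in> \<G>" "insert y b \<in> \<G>" by (auto simp: \<G>_def)
      then have "z \<in> b" using z xy(3) by blast
      then show "b \<in> {b \<in> nsets X (k - 1). z \<in> b}" using b sub by auto
    qed
    then have "card (shared T) \<le> card {b \<in> nsets X (k - 1). z \<in> b}"
      using finX by (intro card_mono) (auto simp: finite_imp_finite_nsets)
    then show ?thesis using card_containing_le[of z] pM by (simp add: algebra_simps)
  next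
    case False
    have "real (card (shared T)) \<le> (real k * p)\<^sup>2 * M"
    proof (rule card_meeting_le[OF sub])
      show "finite G \<and> card G \<le> k" if "G \<in> \<G>" for G using that memberD by (auto simp: \<G>_def)
      show "b \<inter> G \<noteq> {}" if b: "b \<in> shared T" and G: "G \<in> \<G>" for b G
      proof -
        obtain x y where xy: "x \<in> T" "y \<in> T" "x \<noteq> y" "insert x b \<in> \<F>" "insert y b \<in> \<F>"
          using sharedE[OF b T] by metis
        obtain z where "G \<inter> T = {z}" using G by (auto simp: \<G>_def)
        then have "x \<notin> G \<or> y \<notin> G" using xy(1-3) by (metis IntI singletonD)
        then show ?thesis using meetD[OF xy(4), of G] meetD[OF xy(5), of G] G by (auto simp: \<G>_def)
      qed
      show "2 \<le> card S" if "cover S \<G>" for S using two_le_card_cover[OF that False] .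
    qed simp
    then show ?thesis using pM by (simp add: algebra_simps)
  qed
qed

section \<open>Covers of size two\<close>

definition link :: "'a set \<Rightarrow> 'a \<Rightarrow> 'a set set" where
  "link T c = {B \<in> nsets X (k - 1). B \<inter> T = {} \<and> insert c B \<in> \<F>}"

lemma finite_link: "finite (link T c)"
  unfolding link_def using finX by (simp add: finite_imp_finite_nsets)

lemma link_meet:
  assumes "A \<in> link {a, b} a" "B \<in> link {a, b} b" "a \<noteq> b"
  shows "A \<inter> B \<noteq> {}"
  using assms meetD[of "insert a A" "insert b B"] by (auto simp: link_def)

text \<open>
If the link at \<open>a\<close> were empty, every member would contain \<open>b\<close>.
\<close>

lemma link_nonempty:
  assumes "cover {a, b} \<F>"
  shows "link {a, b} a \<noteq> {}"
proof -
  obtain F where F: "F \<in> \<F>" "b \<notin> F" using nontrivial by blast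
  then have "a \<in> F" using assms by (auto simp: cover_def)
  then have "F - {a} \<in> link {a, b} a"
    using F memberD[OF F(1)] by (auto simp: link_def nsets_def insert_absorb)
  then show ?thesis by blast
qed

lemma card_le_links:
  assumes T: "cover {a, b} \<F>" and ab: "a \<noteq> b"
  shows "real (card \<F>) \<le> real (card (link {a, b} a)) + real (card (link {a, b} b)) + p * M"
proof -
  let ?D = "{A \<in> nsets X k. {a, b} \<subseteq> A}" and ?L = "link {a, b}"
  have "\<F> \<subseteq> insert a ` ?L a \<union> (insert b ` ?L b \<union> ?D)"
  proof
    fix F assume F: "F \<in> \<F>"
    have in_link: "F \<in> insert c ` ?L c" if "F \<inter> {a, b} = {c}" for c
    proof -
      have c: "c \<in> F" using that by blast
      have "F - {c} \<in> ?L c"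
        using that c F memberD[OF F] by (auto simp: link_def nsets_def insert_absorb)
      moreover have "F = insert c (F - {c})" using that by blast
      ultimately show ?thesis by blast
    qed
    have "F \<inter> {a, b} \<noteq> {}" using T F by (auto simp: cover_def)
    then consider "F \<inter> {a, b} = {a}" | "F \<inter> {a, b} = {b}" | "{a, b} \<subseteq> F" by blast
    then show "F \<in> insert a ` ?L a \<union> (insert b ` ?L b \<union> ?D)"
      using in_link F uniform by cases auto
  qed
  then have "card \<F> \<le> card (insert a ` ?L a \<union> (insert b ` ?L b \<union> ?D))"
    using finite_link finX by (intro card_mono) (auto simp: finite_imp_finite_nsets)
  also have "\<dots> \<le> card (insert a ` ?L a) + (card (insert b ` ?L b) + card ?D)"
    by (rule order_trans[OF card_Un_le add_left_mono[OF card_Un_le]])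
  also have "\<dots> \<le> card (?L a) + (card (?L b) + card ?D)"
    by (intro add_mono card_image_le finite_link order_refl)
  finally have "real (card \<F>) \<le> real (card (?L a)) + (real (card (?L b)) + real (card ?D))"
    unfolding of_nat_add[symmetric] of_nat_le_iff .
  moreover have "real (card ?D) \<le> p * M"
    using card_nsets_superset_le[OF finX, of k "{a, b}"] k_le_n ab weight_k[of 2]
    by (simp add: power2_eq_square)
  ultimately show ?thesis by linarith
qed

lemma shared_subset_links:
  assumes "cover {a, b} \<F>"
  shows "shared {a, b} \<subseteq> link {a, b} a \<inter> link {a, b} b"
proof
  fix B assume B: "B \<in> shared {a, b}"
  then have "insert a B \<in> \<F> \<and> insert b B \<in> \<F>" using sharedE[OF B assms] by blast
  then show "B \<in> link {a, b} a \<inter> link {a, b} b" using B by (auto simp: shared_def link_def)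
qed

text \<open>
All sets in the link at \<open>b\<close>, and hence all of \<open>shared {a, b}\<close>, pass through \<open>z\<close>. One branching step on
any set of the link at \<open>b\<close> bounds the link at \<open>a\<close>.
\<close>

lemma pair_cover_common:
  assumes T: "cover {a, b} \<F>" and ab: "a \<noteq> b" and z: "\<And>B. B \<in> link {a, b} b \<Longrightarrow> z \<in> B"
  shows "real (card \<F>) + real (card (shared {a, b})) \<le> (real k * p + 3 * p) * M"
proof -
  have T': "cover {b, a} \<F>" using T by (simp add: insert_commute)
  have "link {a, b} b \<subseteq> {B \<in> nsets X (k - 1). z \<in> B}" using z by (auto simp: link_def)
  then have "card (link {a, b} b) \<le> card {B \<in> nsets X (k - 1). z \<in> B}"
    using finX by (intro card_mono) (auto simp: finite_imp_finite_nsets)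
  then have b: "real (card (link {a, b} b)) \<le> p * M" using card_containing_le[of z] by simp
  have "card (shared {a, b}) \<le> card (link {a, b} b)"
    using shared_subset_links[OF T] finite_link by (intro card_mono) auto
  then have s: "real (card (shared {a, b})) \<le> p * M" using b by simp
  have "real (card (link {a, b} a)) \<le> (real k * p) ^ 1 * M"
  proof (rule card_meeting_le[where \<G> = "link {a, b} b"])
    show "1 \<le> card S" if S: "cover S (link {a, b} b)" for S
    proof -
      have "S \<noteq> {}" using S link_nonempty[OF T'] by (auto simp: cover_def insert_commute)
      then show ?thesis using S by (simp add: cover_def Suc_le_eq card_gt_0_iff)
    qed
  qed (use link_meet[OF _ _ ab] in \<open>auto simp: link_def nsets_def\<close>)
  then show ?thesis using card_le_links[OF T ab] b s by (simp add: algebra_simps)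
qed

text \<open>
Neither link is covered by one point, so two branching steps on the other link bound each of them.
Their intersection contains \<open>shared {a, b}\<close>, which accounts for the third copy of \<open>(k p)\<^sup>2\<close>.
\<close>

lemma pair_cover_no_common:
  assumes T: "cover {a, b} \<F>" and ab: "a \<noteq> b"
    and no: "\<nexists>z. \<forall>B\<in>link {a, b} a. z \<in> B" "\<nexists>z. \<forall>B\<in>link {a, b} b. z \<in> B"
  shows "real (card \<F>) + real (card (shared {a, b})) \<le> (3 * (real k * p)\<^sup>2 + p) * M"
proof -
  have a: "real (card (link {a, b} a)) \<le> (real k * p)\<^sup>2 * M"
  proof (rule card_meeting_le[where \<G> = "link {a, b} b"])
    show "2 \<le> card S" if "cover S (link {a, b} b)" for S
      using two_le_card_cover[OF that no(2)] .
    show "A \<inter> B \<noteq> {}" if "A \<in> link {a, b} a" "B \<in> link {a, b} b" for A B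
      using link_meet[OF that ab] .
  qed (auto simp: link_def nsets_def)
  have b: "real (card (link {a, b} b)) \<le> (real k * p)\<^sup>2 * M"
  proof (rule card_meeting_le[where \<G> = "link {a, b} a"])
    show "2 \<le> card S" if "cover S (link {a, b} a)" for S
      using two_le_card_cover[OF that no(1)] .
    show "B \<inter> A \<noteq> {}" if "B \<in> link {a, b} b" "A \<in> link {a, b} a" for A B
      using link_meet[OF that(2,1) ab] by blast
  qed (auto simp: link_def nsets_def)
  have "card (shared {a, b}) \<le> card (link {a, b} b)"
    using shared_subset_links[OF T] finite_link by (intro card_mono) auto
  then show ?thesis using card_le_links[OF T ab] a b by (simp add: algebra_simps)
qed

section \<open>The strict inequality without a common element\<close>

theorem card_wedge_less:
  "card (\<F> \<and>\<^sub>F \<F>) < (\<Sum>i = 0..k - 1. (card X - 1) choose i)"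
proof -
  obtain T where T: "cover T \<F>" and min: "\<And>S. cover S \<F> \<Longrightarrow> card T \<le> card S"
    and T2: "2 \<le> card T" and Tk: "card T \<le> k"
    using obtain_minimum_cover by blast
  define u where "u = real k * p"
  define t where "t = card T"
  define R where "R = real (card \<F>) + real (card (shared T))"
  note pb = p_bounds[folded u_def]
  have u: "0 \<le> u" "u \<le> 1 / 2" using pb by (auto simp: u_def)
  have u2: "u\<^sup>2 \<le> u / 2" using u mult_left_mono[of u "1/2" u] by (simp add: power2_eq_square)
  have p2: "p\<^sup>2 \<le> p / 12" using pb mult_left_mono[of p "1/12" p] by (simp add: power2_eq_square)
  have tp: "real t * p \<le> u" using Tk pb by (simp add: u_def t_def)
  \<comment> \<open>Replacing \<open>u\<^sup>2\<close> by \<open>u / 2\<close> and \<open>p\<^sup>2\<close> by \<open>p / 12\<close> makes all estimates below linear in \<open>u\<close>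
    and \<open>p\<close>; they then follow from \<open>2 u + 8 p \<le> 1\<close>.\<close>
  have "\<exists>c. R \<le> c * M \<and> c + real t * p + 2 * p\<^sup>2 < 1"
  proof (cases "t = 2")
    case True
    then obtain a b where ab: "T = {a, b}" "a \<noteq> b" by (auto simp: t_def card_2_iff)
    note Tab = T[unfolded ab(1)]
    have Tba: "cover {b, a} \<F>" using Tab by (simp add: insert_commute)
    consider "\<exists>z. \<forall>B\<in>link {a, b} b. z \<in> B" | "\<exists>z. \<forall>B\<in>link {a, b} a. z \<in> B"
      | "\<nexists>z. \<forall>B\<in>link {a, b} a. z \<in> B" "\<nexists>z. \<forall>B\<in>link {a, b} b. z \<in> B" by blast
    then have "R \<le> (u + 3 * p) * M \<or> R \<le> (3 * u\<^sup>2 + p) * M"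
    proof cases
      case 1
      then show ?thesis using pair_cover_common[OF Tab ab(2)] by (auto simp: R_def ab u_def)
    next
      case 2
      then show ?thesis using pair_cover_common[OF Tba ab(2)[symmetric]]
        by (auto simp: R_def ab u_def insert_commute)
    next
      case 3
      then show ?thesis using pair_cover_no_common[OF Tab ab(2)] by (auto simp: R_def ab u_def)
    qed
    moreover have tp2: "real t * p = 2 * p" using True by simp
    have "(u + 3 * p) + real t * p + 2 * p\<^sup>2 < 1" "(3 * u\<^sup>2 + p) + real t * p + 2 * p\<^sup>2 < 1"
      using tp2 u u2 p2 pb by linarith+
    ultimately show ?thesis by blast
  next
    case False
    then have t3: "3 \<le> t" using T2 by (simp add: t_def)
    have F: "real (card \<F>) \<le> real t * u ^ (t - 1) * M"
      using card_le_of_minimum_cover[OF T min] T2 by (simp add: t_def u_def)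
    have "R \<le> (real t * u ^ (t - 1) + u\<^sup>2 + p) * M"
      using F card_shared_le[OF T] by (simp add: R_def u_def algebra_simps)
    moreover have "real t * u ^ (t - 1) + u\<^sup>2 + p + real t * p + 2 * p\<^sup>2 < 1"
    \<comment> \<open>For large \<open>t\<close> the term \<open>t p\<close> can only be bounded by \<open>u\<close>, almost \<open>1 / 2\<close>, so \<open>t u\<^bsup>t-1\<^esup>\<close> has to be
      small: \<open>3 / 16\<close> from \<open>t = 6\<close> on. For \<open>t \<le> 5\<close> the term \<open>t p \<le> 5 p\<close> is covered by the slack \<open>8 p\<close>.\<close>
    proof (cases "t \<le> 5")
      case True
      have "real t * u ^ (t - 3) \<le> 3"
      proof -
        have "u ^ (t - 3) \<le> (1 / 2) ^ (t - 3)" using u by (intro power_mono) auto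
        then have "real t * u ^ (t - 3) \<le> real t * (1 / 2) ^ (t - 3)" by (intro mult_left_mono) auto
        moreover have "t = 3 \<or> t = 4 \<or> t = 5" using t3 True by auto
        ultimately show ?thesis using u2 u by (auto simp: power_divide)
      qed
      then have "real t * u ^ (t - 3) * u\<^sup>2 \<le> 3 * u\<^sup>2" by (intro mult_right_mono) auto
      moreover have "t - 1 = (t - 3) + 2" using t3 by simp
      then have "u ^ (t - 1) = u ^ (t - 3) * u\<^sup>2" by (simp only: power_add)
      ultimately have "real t * u ^ (t - 1) \<le> 3 * u\<^sup>2" by (simp add: mult.assoc)
      moreover have "real t * p \<le> 5 * p" using True pb by (intro mult_right_mono) auto
      ultimately show ?thesis using u2 p2 pb by linarith
    next
      case False
      have "6 \<le> t" using False by simp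
      then have "real t * (1 / 2) ^ (t - 1) \<le> 3 / 16"
      proof (induction t rule: nat_induct_at_least)
        case (Suc m)
        have "real (Suc m) * (1 / 2) ^ (Suc m - 1) \<le> real m * (1 / 2) ^ (m - 1)"
          using Suc.hyps by (cases m) (auto simp: field_simps)
        then show ?case using Suc by simp
      qed (auto simp: eval_nat_numeral)
      moreover have "real t * u ^ (t - 1) \<le> real t * (1 / 2) ^ (t - 1)"
        using u by (intro mult_left_mono power_mono) auto
      ultimately show ?thesis using u u2 p2 pb tp by linarith
    qed
    ultimately show ?thesis by blast
  qed
  then obtain c where c: "R \<le> c * M" "c + real t * p + 2 * p\<^sup>2 < 1" by blast
  have "real (card (\<F> \<and>\<^sub>F \<F>)) \<le> real (\<Sum>i\<le>k - 2. (card X - 1) choose i) + (R + real t * (p * M) + 2 * p\<^sup>2 * M)"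
    using card_wedge_bound[OF T] by (simp add: R_def t_def)
  also have "\<dots> \<le> real (\<Sum>i\<le>k - 2. (card X - 1) choose i) + (c + real t * p + 2 * p\<^sup>2) * M"
    using c(1) by (simp add: algebra_simps)
  also have "\<dots> < real (\<Sum>i\<le>k - 2. (card X - 1) choose i) + M"
    using c(2) M_pos by simp
  also have "\<dots> = real (\<Sum>i = 0..k - 1. (card X - 1) choose i)"
  proof -
    have "{0..k - 1} = insert (k - 1) {..k - 2}" "k - 1 \<notin> {..k - 2}" using k2 by auto
    then show ?thesis by (simp add: M_def)
  qed
  finally show ?thesis by (simp only: of_nat_less_iff)
qed

end

section \<open>Stars\<close>

lemma card_small_sets_through:
  assumes X: "finite X" "x \<in> X" and k: "0 < k"
  shows "card {S. S \<subseteq> X \<and> x \<in> S \<and> card S \<le> k} = (\<Sum>i = 0..k - 1. (card X - 1) choose i)"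
proof -
  let ?U = "\<Union>i\<in>{0..k - 1}. nsets (X - {x}) i"
  have "{S. S \<subseteq> X \<and> x \<in> S \<and> card S \<le> k} = insert x ` ?U"
  proof (intro equalityI subsetI)
    fix S assume "S \<in> {S. S \<subseteq> X \<and> x \<in> S \<and> card S \<le> k}"
    then have S: "S \<subseteq> X" "x \<in> S" "card S \<le> k" "finite S" using X finite_subset by auto
    then have "S - {x} \<in> ?U" by (auto simp: nsets_def)
    moreover have "S = insert x (S - {x})" using S by blast
    ultimately show "S \<in> insert x ` ?U" by blast
  next
    fix S assume "S \<in> insert x ` ?U"
    then obtain A where A: "S = insert x A" "A \<in> ?U" by blast
    then have A': "A \<subseteq> X - {x}" "finite A" "card A \<le> k - 1" by (auto simp: nsets_def)
    then have "card S \<le> k" using k A(1) by (auto simp: card_insert_if)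
    then show "S \<in> {S. S \<subseteq> X \<and> x \<in> S \<and> card S \<le> k}" using A(1) A'(1) X(2) by auto
  qed
  moreover have "inj_on (insert x) ?U"
  proof (rule inj_onI)
    fix A B assume "A \<in> ?U" "B \<in> ?U" and eq: "insert x A = insert x B"
    then have "x \<notin> A" "x \<notin> B" by (auto simp: nsets_def)
    then show "A = B" using eq by (simp add: insert_ident)
  qed
  moreover have "card ?U = (\<Sum>i\<in>{0..k - 1}. card (nsets (X - {x}) i))"
    using X by (intro card_UN_disjoint) (auto simp: finite_imp_finite_nsets, auto simp: nsets_def)
  ultimately show ?thesis using X by (simp add: card_image card_nsets)
qed

text \<open>
A set \<open>S\<close> of size at most \<open>k\<close> through \<open>x\<close> extends to two \<open>k\<close>-sets by disjoint sets outside \<open>S\<close>; the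
room for both is what \<open>2 * k \<le> card X\<close> provides.
\<close>

lemma star_wedge_star:
  assumes X: "finite X" and k: "2 * k \<le> card X"
  shows "{S \<in> nsets X k. x \<in> S} \<and>\<^sub>F {S \<in> nsets X k. x \<in> S} = {S. S \<subseteq> X \<and> x \<in> S \<and> card S \<le> k}"
proof (intro equalityI subsetI)
  fix S assume "S \<in> {S \<in> nsets X k. x \<in> S} \<and>\<^sub>F {S \<in> nsets X k. x \<in> S}"
  then show "S \<in> {S. S \<subseteq> X \<and> x \<in> S \<and> card S \<le> k}"
    by (auto simp: wedge_def nsets_def card_mono)
next
  fix S assume "S \<in> {S. S \<subseteq> X \<and> x \<in> S \<and> card S \<le> k}"
  then have S: "S \<subseteq> X" "x \<in> S" "card S \<le> k" "finite S" using X finite_subset by auto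
  have "2 * (k - card S) \<le> card (X - S)" using S k by (simp add: card_Diff_subset)
  then obtain D where D: "D \<subseteq> X - S" "card D = 2 * (k - card S)" "finite D"
    using obtain_subset_with_card_n by metis
  then obtain E where E: "E \<subseteq> D" "card E = k - card S" "finite E"
    using obtain_subset_with_card_n[of "k - card S" D] by auto
  have "card (D - E) = k - card S" using D E by (simp add: card_Diff_subset)
  moreover have "S \<inter> E = {}" "S \<inter> (D - E) = {}" using D E by auto
  ultimately have "card (S \<union> E) = k" "card (S \<union> (D - E)) = k"
    using S D E by (simp_all add: card_Un_disjoint)
  then have "S \<union> E \<in> {S \<in> nsets X k. x \<in> S}" "S \<union> (D - E) \<in> {S \<in> nsets X k. x \<in> S}"
    using S D E by (auto simp: nsets_def)
  moreover have "S = (S \<union> E) \<inter> (S \<union> (D - E))" by blast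
  ultimately show "S \<in> {S \<in> nsets X k. x \<in> S} \<and>\<^sub>F {S \<in> nsets X k. x \<in> S}"
    unfolding wedge_def by blast
qed

lemma permute_full_star:
  assumes \<pi>: "\<pi> permutes {1..n}"
  shows "(\<lambda>S. \<pi> ` S) ` full_star n k i = full_star n k (\<pi> i)"
proof -
  have sub: "(\<lambda>S. \<sigma> ` S) ` full_star n k j \<subseteq> full_star n k (\<sigma> j)" if "\<sigma> permutes {1..n}" for \<sigma> j
  proof -
    have "inj \<sigma>" using that by (rule permutes_inj)
    then have "card (\<sigma> ` S) = card S" for S by (meson card_image inj_on_subset subset_UNIV)
    moreover have "\<sigma> ` S \<subseteq> {1..n}" if "S \<subseteq> {1..n}" for S
      using that permutes_image[OF \<open>\<sigma> permutes {1..n}\<close>] by blast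
    ultimately show ?thesis by (auto simp: full_star_def nsets_def)
  qed
  have "full_star n k (\<pi> i) \<subseteq> (\<lambda>S. \<pi> ` S) ` full_star n k i"
  proof
    fix S assume "S \<in> full_star n k (\<pi> i)"
    then have "inv \<pi> ` S \<in> full_star n k i"
      using sub[OF permutes_inv[OF \<pi>], of "\<pi> i"] permutes_inverses[OF \<pi>] by auto
    moreover have "S = \<pi> ` (inv \<pi> ` S)" using permutes_inverses[OF \<pi>] by (simp add: image_image)
    ultimately show "S \<in> (\<lambda>S. \<pi> ` S) ` full_star n k i" by blast
  qed
  then show ?thesis using sub[OF \<pi>] by blast
qed

text \<open>
Up to isomorphism there is only one star: a permutation moves the centre, and a transposition moves it
to any given point.
\<close>

lemma isomorphic_full_star_iff:
  assumes "0 < n"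
  shows "isomorphic_on {1..n} \<F> (full_star n k 1) \<longleftrightarrow> (\<exists>x\<in>{1..n}. \<F> = full_star n k x)"
proof
  assume "isomorphic_on {1..n} \<F> (full_star n k 1)"
  then obtain \<pi> where \<pi>: "\<pi> permutes {1..n}" "\<F> = (\<lambda>S. \<pi> ` S) ` full_star n k 1"
    by (auto simp: isomorphic_on_def)
  have "\<pi> 1 \<in> {1..n}" using permutes_in_image[OF \<pi>(1), of 1] assms by simp
  then show "\<exists>x\<in>{1..n}. \<F> = full_star n k x" using \<pi> permute_full_star[OF \<pi>(1)] by blast
next
  assume "\<exists>x\<in>{1..n}. \<F> = full_star n k x"
  then obtain x where x: "x \<in> {1..n}" "\<F> = full_star n k x" by blast
  have \<pi>: "transpose 1 x permutes {1..n}" using x assms by (intro permutes_swap_id) auto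
  show "isomorphic_on {1..n} \<F> (full_star n k 1)"
    unfolding isomorphic_on_def using \<pi> permute_full_star[OF \<pi>, of k 1] x(2) by auto
qed

theorem corollary1p4:
  fixes n k :: nat and \<F> :: "nat set set"
  assumes "n > 0" and "k > 0"
    and "n \<ge> 2 * k\<^sup>2 + 8 * k"
    and "\<F> \<subseteq> nsets {1..n} k"
    and "intersecting \<F>"
  shows "card (\<F> \<and>\<^sub>F \<F>) \<le> (\<Sum>i = 0..k - 1. (n - 1) choose i)
    \<and> (card (\<F> \<and>\<^sub>F \<F>) = (\<Sum>i = 0..k - 1. (n - 1) choose i)
        \<longleftrightarrow> isomorphic_on {1..n} \<F> (full_star n k 1))"
proof (cases "\<exists>x\<in>{1..n}. \<forall>F\<in>\<F>. x \<in> F")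
  case True
  then obtain x where x: "x \<in> {1..n}" "\<And>F. F \<in> \<F> \<Longrightarrow> x \<in> F" by blast
  define U where "U y = {S. S \<subseteq> {1..n} \<and> y \<in> S \<and> card S \<le> k}" for y
  have cardU: "card (U y) = (\<Sum>i = 0..k - 1. (n - 1) choose i)" if "y \<in> {1..n}" for y
    unfolding U_def using card_small_sets_through[OF _ that \<open>k > 0\<close>] by simp
  have finU: "finite (U x)" unfolding U_def by (rule finite_subset[of _ "Pow {1..n}"]) auto
  have star: "full_star n k y \<and>\<^sub>F full_star n k y = U y" for y
    unfolding full_star_def U_def using assms(3) by (intro star_wedge_star) auto
  have sub: "\<F> \<subseteq> full_star n k x" using x assms(4) by (auto simp: full_star_def)
  then have wsub: "\<F> \<and>\<^sub>F \<F> \<subseteq> U x" unfolding star[symmetric] by (auto simp: wedge_def)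
  \<comment> \<open>If the bound is attained, every \<open>k\<close>-set through \<open>x\<close> is an intersection of two members, and it is
    too large to be a proper subset of either.\<close>
  have "\<F> = full_star n k x" if "card (\<F> \<and>\<^sub>F \<F>) = card (U x)"
  proof (rule antisym[OF sub], rule subsetI)
    fix S assume S: "S \<in> full_star n k x"
    then have "S \<in> U x" by (auto simp: full_star_def U_def nsets_def)
    then have "S \<in> \<F> \<and>\<^sub>F \<F>" using card_subset_eq[OF finU wsub that] by simp
    then obtain F G where FG: "F \<in> \<F>" "S = F \<inter> G" by (auto simp: wedge_def)
    have "S = F" using S FG assms(4) by (intro card_subset_eq) (auto simp: full_star_def nsets_def)
    then show "S \<in> \<F>" using FG by simp
  qed
  then show ?thesis
    unfolding isomorphic_full_star_iff[OF \<open>n > 0\<close>]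
    using card_mono[OF finU wsub] cardU star x(1) by metis
next
  case False
  have nontriv: "nontrivial_intersecting {1..n} \<F> k"
  proof
    show "\<exists>F\<in>\<F>. x \<notin> F" for x
    proof (cases "x \<in> {1..n}")
      case outside: False
      have "\<F> \<noteq> {}" using False \<open>n > 0\<close> by fastforce
      then show ?thesis using assms(4) outside by (fastforce simp: nsets_def)
    qed (use False in blast)
  qed (use assms in auto)
  have less: "card (\<F> \<and>\<^sub>F \<F>) < (\<Sum>i = 0..k - 1. (n - 1) choose i)"
    using nontrivial_intersecting.card_wedge_less[OF nontriv] by simp
  moreover have "\<not> isomorphic_on {1..n} \<F> (full_star n k 1)"
    unfolding isomorphic_full_star_iff[OF \<open>n > 0\<close>] using False by (auto simp: full_star_def)
  ultimately show ?thesis by simp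
qed

end
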